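(* Let $A$ be a Banach algebra and $B$ a left Banach $A$-module with action $\pi_\ell:A\times B\to B$. Consider the following statements. (1) $B^*A\subseteq wap_\ell(B)$. (2) $AA^{**}\subseteq Z_{B^{**}}(A^{**})$. (3) $AA^{**}\subseteq A\,Z_{B^{**}}((A^*A)^* )$. Then (1) $\Leftrightarrow$ (2) $\Leftarrow$ (3).
   Context: For a bounded bilinear $m:X\times Y\to Z$ of normed spaces: $m^*:Z^*\times X\to Y^*$, $\langle m^*(z',x),y\rangle=\langle z',m(x,y)\rangle$; $m^{**}:Y^{**}\times Z^*\to X^*$, $\langle m^{**}(y'',z'),x\rangle=\langle y'',m^*(z',x)\rangle$; $m^{***}:X^{**}\times Y^{**}\to Z^{**}$, $\langle m^{***}(x'',y''),z'\rangle=\langle x'',m^{**}(y'',z')\rangle$. $B^*$ is a right $A$-module via $b'a=\pi_\ell^*(b',a)$, i.e. $\langle b'a,b\rangle=\langle b',ab\rangle$; $B^*A=\{b'a:b'\in B^*,a\in A\}$. Likewise $\langle a'a,c\rangle=\langle a',ac\rangle$ for $a'\in A^*$, $a,c\in A$, and $A^*A=\{a'a:a'\in A^*,a\in A\}$, understood as a closed linear subspace of $A^*$, i.e. replaced by its closed linear span when necessary (the set itself is a closed subspace when $A$ has a bounded approximate identity). For $a\in A$, $a''\in A^{**}$, the Arens product $aa''\in A^{**}$ is $\langle aa'',a'\rangle=\langle a'',a'a\rangle$; $AA^{**}=\{aa'':a\in A,a''\in A^{**}\}$. For $F\in(A^*A)^*$ and $a\in A$, $aF\in A^{**}$ is given by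 $\langle aF,a'\rangle=\langle F,a'a\rangle$, and $A\,Z_{B^{**}}((A^*A)^* )=\{aF:a\in A,F\in Z_{B^{**}}((A^*A)^* )\}$. $wap_\ell(B)$ is the closed subspace of $B^*$ consisting of all $b'\in B^*$ such that $\{\pi_\ell^*(b',a):a\in A,\|a\|\le1\}$ is relatively weakly compact in $B^*$. $Z_{B^{**}}(A^{**})$ is the set of $a''\in A^{**}$ such that $b''\mapsto\pi_\ell^{***}(a'',b'')$ is weak$^*$-to-weak$^*$ continuous from $B^{**}$ to $B^{**}$. $Z_{B^{**}}((A^*A)^* )$ is the set of $F\in(A^*A)^*$ such that $b''\mapsto\pi_\ell^{***}(F,b'')$ is a weak$^*$-to-weak$^*$ continuous map from $B^{**}$ to $B^{**}$, where $\langle\pi_\ell^{***}(F,b''),b'\rangle=\langle F,\pi_\ell^{**}(b'',b')\rangle$; membership is understood to include that this formula defines the map, i.e. that $F$ is evaluated only at elements of $A^*A$. *)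

theory Defs
  imports "HOL-Analysis.Analysis"
begin

text \<open>
  The scalar field is a type of the classes \<open>real_normed_field\<close> and \<open>euclidean_space\<close>;
  \<open>real\<close> and \<open>complex\<close> are instances, so real and complex Banach algebras
  are covered at once. The library's norm and real vector space structure are used throughout; the
  scalar multiplication by the field is an explicit argument extending the one by the reals.
\<close>

locale normed_space_over = vector_space scl
  for scl :: "'k::{real_normed_field,euclidean_space} \<Rightarrow> 'v::real_normed_vector \<Rightarrow> 'v" +
  assumes scale_of_real: "scl (of_real r) x = r *\<^sub>R x"
    and norm_scale: "norm (scl c x) = norm c * norm x"

lemma normed_space_over_real: "normed_space_over (scaleR :: real \<Rightarrow> 'v::real_normed_vector \<Rightarrow> 'v)"
  by unfold_locales (auto simp: algebra_simps)

lemma normed_space_over_complex: "normed_space_over ((*) :: complex \<Rightarrow> complex \<Rightarrow> complex)"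
  by unfold_locales (auto simp: algebra_simps norm_mult scaleR_conv_of_real)

locale banach_algebra_over = normed_space_over scl
  for scl :: "'k::{real_normed_field,euclidean_space} \<Rightarrow> 'a::{real_normed_algebra,banach} \<Rightarrow> 'a" +
  assumes scale_mult_left: "scl c x * y = scl c (x * y)"
    and scale_mult_right: "x * scl c y = scl c (x * y)"

locale left_banach_module =
  A: banach_algebra_over scaleA + B: normed_space_over scaleB
  for scaleA :: "'k::{real_normed_field,euclidean_space} \<Rightarrow> 'a::{real_normed_algebra,banach} \<Rightarrow> 'a"
    and scaleB :: "'k \<Rightarrow> 'b::banach \<Rightarrow> 'b" +
  fixes act :: "'a \<Rightarrow> 'b \<Rightarrow> 'b"
  assumes act_bounded_bilinear: "bounded_bilinear act"
    and act_scale_left: "act (scaleA c a) b = scaleB c (act a b)"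
    and act_scale_right: "act a (scaleB c b) = scaleB c (act a b)"
    and act_mult: "act (x * y) b = act x (act y b)"


section \<open>Duals and biduals\<close>

text \<open>
  The topological dual consists of the field-linear elements of the library's space of bounded
  real-linear maps into the field, with the operator norm. The dual of a subspace \<open>S\<close> of a dual is
  a set of functions made extensional outside \<open>S\<close>, so that equality means equality on \<open>S\<close>.
\<close>

definition dual :: "('k \<Rightarrow> 'v \<Rightarrow> 'v) \<Rightarrow> ('v::real_normed_vector \<Rightarrow>\<^sub>L 'k::real_normed_field) set" where
  "dual scl = {f. \<forall>c x. blinfun_apply f (scl c x) = c * blinfun_apply f x}"

definition dual_scale ::
  "'k \<Rightarrow> ('v::real_normed_vector \<Rightarrow>\<^sub>L 'k::real_normed_field) \<Rightarrow> ('v \<Rightarrow>\<^sub>L 'k)" where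
  "dual_scale c f = blinfun_mult_right c o\<^sub>L f"

lemma dual_scale_apply [simp]: "blinfun_apply (dual_scale c f) x = c * blinfun_apply f x"
  by (simp add: dual_scale_def)

lemma module_dual_scale: "module dual_scale"
  by unfold_locales (auto intro!: blinfun_eqI simp: blinfun.bilinear_simps algebra_simps)

definition dual_of_subspace ::
  "('v::real_normed_vector \<Rightarrow>\<^sub>L 'k::real_normed_field) set \<Rightarrow> (('v \<Rightarrow>\<^sub>L 'k) \<Rightarrow> 'k) set" where
  "dual_of_subspace S = {F \<in> extensional S.
     (\<forall>f\<in>S. \<forall>g\<in>S. F (f + g) = F f + F g) \<and>
     (\<forall>c. \<forall>f\<in>S. F (dual_scale c f) = c * F f) \<and>
     (\<exists>K. \<forall>f\<in>S. norm (F f) \<le> K * norm f)}"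

definition bidual ::
  "('k \<Rightarrow> 'v \<Rightarrow> 'v) \<Rightarrow> (('v::real_normed_vector \<Rightarrow>\<^sub>L 'k::real_normed_field) \<Rightarrow> 'k) set" where
  "bidual scl = dual_of_subspace (dual scl)"

text \<open>The weak topology on the dual and the weak-star topology on the bidual.\<close>

definition weak_topology_dual ::
  "('k \<Rightarrow> 'v \<Rightarrow> 'v) \<Rightarrow> ('v::real_normed_vector \<Rightarrow>\<^sub>L 'k::real_normed_field) topology" where
  "weak_topology_dual scl =
     topology_generated_by {{f \<in> dual scl. F f \<in> U} | F U. F \<in> bidual scl \<and> open U}"

definition weak_star_topology_bidual ::
  "('k \<Rightarrow> 'v \<Rightarrow> 'v) \<Rightarrow> (('v::real_normed_vector \<Rightarrow>\<^sub>L 'k::real_normed_field) \<Rightarrow> 'k) topology" where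
  "weak_star_topology_bidual scl =
     topology_generated_by {{F \<in> bidual scl. F f \<in> U} | f U. f \<in> dual scl \<and> open U}"


section \<open>Adjoints of a bounded bilinear map\<close>

text \<open>
  For \<open>m : X \<times> Y \<rightarrow> Z\<close> these are \<open>m\<^sup>*\<close>, \<open>m\<^sup>*\<^sup>*\<close> and \<open>m\<^sup>*\<^sup>*\<^sup>*\<close>. The second and third formulas also make
  sense for functionals given on a subspace only, which is how \<open>m\<^sup>*\<^sup>*\<^sup>*\<close> is applied below to
  functionals on \<open>A\<^sup>*A\<close>.
\<close>

definition adj1 :: "('x \<Rightarrow> 'y \<Rightarrow> 'z) \<Rightarrow>
    ('z::real_normed_vector \<Rightarrow>\<^sub>L 'k::real_normed_field) \<Rightarrow> 'x \<Rightarrow> ('y::real_normed_vector \<Rightarrow>\<^sub>L 'k)" where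
  "adj1 m z' x = Blinfun (\<lambda>y. blinfun_apply z' (m x y))"

definition adj2 :: "('x \<Rightarrow> 'y \<Rightarrow> 'z) \<Rightarrow> (('y::real_normed_vector \<Rightarrow>\<^sub>L 'k) \<Rightarrow> 'k) \<Rightarrow>
    ('z::real_normed_vector \<Rightarrow>\<^sub>L 'k::real_normed_field) \<Rightarrow> ('x::real_normed_vector \<Rightarrow>\<^sub>L 'k)" where
  "adj2 m y'' z' = Blinfun (\<lambda>x. y'' (adj1 m z' x))"

definition adj3 :: "('k \<Rightarrow> 'z \<Rightarrow> 'z) \<Rightarrow> ('x \<Rightarrow> 'y \<Rightarrow> 'z) \<Rightarrow>
    (('x::real_normed_vector \<Rightarrow>\<^sub>L 'k) \<Rightarrow> 'k) \<Rightarrow> (('y::real_normed_vector \<Rightarrow>\<^sub>L 'k) \<Rightarrow> 'k) \<Rightarrow>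
    (('z::real_normed_vector \<Rightarrow>\<^sub>L 'k::real_normed_field) \<Rightarrow> 'k)" where
  "adj3 scaleZ m x'' y'' = restrict (\<lambda>z'. x'' (adj2 m y'' z')) (dual scaleZ)"

text \<open>The arguments of \<open>Blinfun\<close> above are bounded linear maps, and the results lie in the duals.\<close>

lemma adj1_apply:
  assumes "bounded_bilinear m"
  shows "blinfun_apply (adj1 m z' x) y = blinfun_apply z' (m x y)"
proof -
  have "bounded_linear (\<lambda>y. blinfun_apply z' (m x y))"
    by (intro bounded_linear_compose[OF blinfun.bounded_linear_right]
        bounded_bilinear.bounded_linear_right[OF assms])
  then show ?thesis
    by (simp add: adj1_def bounded_linear_Blinfun_apply)
qed

lemma adj1_in_dual:
  assumes "bounded_bilinear m" "\<And>c x y. m x (scaleY c y) = scaleZ c (m x y)" "z' \<in> dual scaleZ"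
  shows "adj1 m z' x \<in> dual scaleY"
  using assms by (simp add: dual_def adj1_apply)

lemma adj2_apply:
  assumes m: "bounded_bilinear m"
    and mY: "\<And>c x y. m x (scaleY c y) = scaleZ c (m x y)"
    and X: "normed_space_over scaleX"
    and mX: "\<And>c x y. m (scaleX c x) y = scaleZ c (m x y)"
    and z: "z' \<in> dual scaleZ" and y: "y'' \<in> bidual scaleY"
  shows "blinfun_apply (adj2 m y'' z') x = y'' (adj1 m z' x)"
    and "adj2 m y'' z' \<in> dual scaleX"
proof -
  note D = adj1_in_dual[OF m mY z]
  have add: "adj1 m z' (u + v) = adj1 m z' u + adj1 m z' v" for u v
    by (rule blinfun_eqI)
      (simp add: adj1_apply[OF m] blinfun.bilinear_simps bounded_bilinear.add_left[OF m])
  have sc: "adj1 m z' (scaleX c u) = dual_scale c (adj1 m z' u)" for c u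
    using z by (intro blinfun_eqI) (simp add: adj1_apply[OF m] mX dual_def)
  from y obtain K where K: "\<forall>f\<in>dual scaleY. norm (y'' f) \<le> K * norm f"
    unfolding bidual_def dual_of_subspace_def by blast
  obtain L where L: "\<And>u v. norm (m u v) \<le> norm u * norm v * L" and L0: "L \<ge> 0"
    using bounded_bilinear.nonneg_bounded[OF m] by auto
  have N: "norm (adj1 m z' u) \<le> norm z' * L * norm u" for u
  proof (rule norm_blinfun_bound)
    fix v
    have "norm (z' (m u v)) \<le> norm z' * norm (m u v)" by (rule norm_blinfun)
    also have "\<dots> \<le> norm z' * (norm u * norm v * L)" by (intro mult_left_mono L) auto
    finally show "norm (adj1 m z' u v) \<le> norm z' * L * norm u * norm v"
      by (simp add: adj1_apply[OF m] ac_simps)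
  qed (use L0 in auto)
  have scl: "y'' (adj1 m z' (scaleX c u)) = c * y'' (adj1 m z' u)" for c u
    using y D by (simp add: bidual_def dual_of_subspace_def sc)
  have "bounded_linear (\<lambda>x. y'' (adj1 m z' x))"
  proof (rule bounded_linear_intro)
    fix u v r
    show "y'' (adj1 m z' (u + v)) = y'' (adj1 m z' u) + y'' (adj1 m z' v)"
      using y D by (simp add: bidual_def dual_of_subspace_def add)
    show "y'' (adj1 m z' (r *\<^sub>R u)) = r *\<^sub>R y'' (adj1 m z' u)"
      using scl[of "of_real r" u] by (simp add: normed_space_over.scale_of_real[OF X] scaleR_conv_of_real)
    have "norm (y'' (adj1 m z' u)) \<le> K * norm (adj1 m z' u)" using K D by blast
    also have "\<dots> \<le> \<bar>K\<bar> * norm (adj1 m z' u)" by (intro mult_right_mono) auto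
    also have "\<dots> \<le> \<bar>K\<bar> * (norm z' * L * norm u)" by (intro mult_left_mono N) auto
    finally show "norm (y'' (adj1 m z' u)) \<le> norm u * (\<bar>K\<bar> * norm z' * L)" by (simp add: ac_simps)
  qed
  then show *: "blinfun_apply (adj2 m y'' z') x = y'' (adj1 m z' x)" for x
    by (simp add: adj2_def bounded_linear_Blinfun_apply)
  show "adj2 m y'' z' \<in> dual scaleX"
    by (simp add: dual_def * scl)
qed


section \<open>Module products and topological centres\<close>

definition BstarA :: "('k \<Rightarrow> 'b \<Rightarrow> 'b) \<Rightarrow> ('a \<Rightarrow> 'b \<Rightarrow> 'b) \<Rightarrow>
    ('b::real_normed_vector \<Rightarrow>\<^sub>L 'k::real_normed_field) set" where
  "BstarA scaleB act = {adj1 act b' a | b' a. b' \<in> dual scaleB}"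

definition AstarA :: "('k \<Rightarrow> 'a \<Rightarrow> 'a) \<Rightarrow> ('a::real_normed_algebra \<Rightarrow>\<^sub>L 'k::real_normed_field) set" where
  "AstarA scaleA = closure (module.span dual_scale {adj1 (*) a' a | a' a. a' \<in> dual scaleA})"

text \<open>\<open>lmult scaleA a F\<close> is \<open>aF\<close>, for \<open>F\<close> in \<open>A\<^sup>*\<^sup>*\<close> (the Arens product) or in \<open>(A\<^sup>*A)\<^sup>*\<close>.\<close>

definition lmult :: "('k \<Rightarrow> 'a \<Rightarrow> 'a) \<Rightarrow> 'a \<Rightarrow>
    (('a::real_normed_algebra \<Rightarrow>\<^sub>L 'k::real_normed_field) \<Rightarrow> 'k) \<Rightarrow> (('a \<Rightarrow>\<^sub>L 'k) \<Rightarrow> 'k)" where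
  "lmult scaleA a F = restrict (\<lambda>a'. F (adj1 (*) a' a)) (dual scaleA)"

definition A_mult :: "('k \<Rightarrow> 'a \<Rightarrow> 'a) \<Rightarrow>
    (('a::real_normed_algebra \<Rightarrow>\<^sub>L 'k::real_normed_field) \<Rightarrow> 'k) set \<Rightarrow> (('a \<Rightarrow>\<^sub>L 'k) \<Rightarrow> 'k) set" where
  "A_mult scaleA T = {lmult scaleA a F | a F. F \<in> T}"

definition wap_l :: "('k \<Rightarrow> 'b \<Rightarrow> 'b) \<Rightarrow> ('a::real_normed_vector \<Rightarrow> 'b \<Rightarrow> 'b) \<Rightarrow>
    ('b::real_normed_vector \<Rightarrow>\<^sub>L 'k::real_normed_field) set" where
  "wap_l scaleB act = {b' \<in> dual scaleB.
     compactin (weak_topology_dual scaleB)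
       (weak_topology_dual scaleB closure_of {adj1 act b' a | a. norm a \<le> 1})}"

definition Z_bidual :: "('k \<Rightarrow> 'a \<Rightarrow> 'a) \<Rightarrow> ('k \<Rightarrow> 'b \<Rightarrow> 'b) \<Rightarrow>
    ('a::real_normed_vector \<Rightarrow> 'b::real_normed_vector \<Rightarrow> 'b) \<Rightarrow>
    (('a \<Rightarrow>\<^sub>L 'k::real_normed_field) \<Rightarrow> 'k) set" where
  "Z_bidual scaleA scaleB act = {a'' \<in> bidual scaleA.
     continuous_map (weak_star_topology_bidual scaleB) (weak_star_topology_bidual scaleB)
       (\<lambda>b''. adj3 scaleB act a'' b'')}"

text \<open>
  A functional on \<open>A\<^sup>*A\<close> has no meaningful values elsewhere; hence the explicit requirement that
  \<open>\<pi>\<^sup>*\<^sup>*(b'', b')\<close> always lies in \<open>A\<^sup>*A\<close>.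
\<close>

definition Z_AstarA_dual :: "('k \<Rightarrow> 'a \<Rightarrow> 'a) \<Rightarrow> ('k \<Rightarrow> 'b \<Rightarrow> 'b) \<Rightarrow>
    ('a::real_normed_algebra \<Rightarrow> 'b::real_normed_vector \<Rightarrow> 'b) \<Rightarrow>
    (('a \<Rightarrow>\<^sub>L 'k::real_normed_field) \<Rightarrow> 'k) set" where
  "Z_AstarA_dual scaleA scaleB act = {F \<in> dual_of_subspace (AstarA scaleA).
     (\<forall>b''\<in>bidual scaleB. \<forall>b'\<in>dual scaleB. adj2 act b'' b' \<in> AstarA scaleA) \<and>
     continuous_map (weak_star_topology_bidual scaleB) (weak_star_topology_bidual scaleB)
       (\<lambda>b''. adj3 scaleB act F b'')}"

end

theory Submission
  imports Defs
begin

text \<open>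
  With \<open>f = b'a\<close>, the module law gives \<open>\<langle>\<pi>\<^sup>*\<^sup>*\<^sup>*(aa'', b''), b'\<rangle> = \<langle>a'', \<pi>\<^sup>*\<^sup>*(b'', f)\<rangle>\<close>, so (2) says that
  \<open>b'' \<mapsto> \<langle>a'', \<pi>\<^sup>*\<^sup>*(b'', f)\<rangle>\<close> is weak-star continuous for all \<open>a''\<close> and all \<open>f\<close> in \<open>B\<^sup>*A\<close>. As
  \<open>b'' \<mapsto> \<pi>\<^sup>*\<^sup>*(b'', f)\<close> is the adjoint of \<open>T : A \<rightarrow> B\<^sup>*\<close>, \<open>T a = \<pi>\<^sup>*(f, a)\<close>, this means that the second
  adjoint of \<open>T\<close> takes values in \<open>B\<^sup>*\<close>, which by Gantmacher's theorem is weak compactness of \<open>T\<close>,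
  i.e. \<open>f \<in> wap\<^sub>\<ell>(B)\<close>. The same formula with \<open>F\<close> in place of \<open>a''\<close> gives (3) \<open>\<Rightarrow>\<close> (2).
\<close>

section \<open>Initial topologies\<close>

text \<open>The weak topology on a dual and the weak-star topology on a bidual both have this form,
  with points and indices exchanged. An empty \<open>I\<close> would leave no generating set and
  hence an empty carrier, which explains the hypothesis \<open>I \<noteq> {}\<close> below.\<close>

definition initial_topology :: "'x set \<Rightarrow> 'i set \<Rightarrow> ('i \<Rightarrow> 'x \<Rightarrow> 'c::topological_space) \<Rightarrow> 'x topology"
  where "initial_topology X I e =
    topology_generated_by {{x \<in> X. e i x \<in> U} | i U. i \<in> I \<and> open U}"

lemma topspace_initial_topology:
  assumes "I \<noteq> {}"
  shows "topspace (initial_topology X I e) = X"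
proof -
  obtain i where "i \<in> I" using assms by auto
  then have "X \<in> {{x \<in> X. e i x \<in> U} | i U. i \<in> I \<and> open U}"
    by (intro CollectI exI[of _ i] exI[of _ UNIV]) auto
  then show ?thesis
    unfolding initial_topology_def topology_generated_by_topspace by blast
qed

lemma continuous_map_initial_eval:
  assumes "i \<in> I"
  shows "continuous_map (initial_topology X I e) euclidean (e i)"
proof -
  have I: "I \<noteq> {}" using assms by auto
  have "openin (initial_topology X I e) {x \<in> X. e i x \<in> U}" if "open U" for U
    unfolding initial_topology_def by (rule topology_generated_by_Basis) (use assms that in blast)
  then show ?thesis
    by (simp add: continuous_map_def topspace_initial_topology[OF I])
qed

lemma continuous_map_into_initial_topology:
  assumes "I \<noteq> {}" "\<And>z. z \<in> topspace Z \<Longrightarrow> g z \<in> X"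
    and "\<And>i. i \<in> I \<Longrightarrow> continuous_map Z euclidean (\<lambda>z. e i (g z))"
  shows "continuous_map Z (initial_topology X I e) g"
  unfolding initial_topology_def
proof (rule continuous_on_generated_topo)
  show "g ` topspace Z \<subseteq> \<Union>{{x \<in> X. e i x \<in> U} | i U. i \<in> I \<and> open U}"
    using assms(1,2) topspace_initial_topology[of I X e]
    by (auto simp: initial_topology_def)
next
  fix V assume "V \<in> {{x \<in> X. e i x \<in> U} | i U. i \<in> I \<and> open U}"
  then obtain i U where V: "V = {x \<in> X. e i x \<in> U}" "i \<in> I" "open U" by blast
  have "openin Z {z \<in> topspace Z. e i (g z) \<in> U}"
    using openin_continuous_map_preimage[OF assms(3)[OF V(2)]] V(3) by auto
  moreover have "g -` V \<inter> topspace Z = {z \<in> topspace Z. e i (g z) \<in> U}"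
    using assms(2) V(1) by auto
  ultimately show "openin Z (g -` V \<inter> topspace Z)" by simp
qed

text \<open>Closeness at finitely many indices with a single tolerance is the kind of condition that
  Helly's lemma can meet. The induction follows the generation of the open set; an intersection
  takes the union of the index sets and the smaller tolerance.\<close>

lemma initial_topology_basic_neighbourhood:
  fixes e :: "'i \<Rightarrow> 'x \<Rightarrow> 'c::metric_space"
  assumes "openin (initial_topology X I e) U" "x \<in> U"
  obtains J \<epsilon> where "finite J" "J \<subseteq> I" "\<epsilon> > 0"
    "\<And>y. y \<in> X \<Longrightarrow> (\<And>i. i \<in> J \<Longrightarrow> dist (e i y) (e i x) < \<epsilon>) \<Longrightarrow> y \<in> U"
proof -
  define S where "S = {{x \<in> X. e i x \<in> U} | i U. i \<in> I \<and> open U}"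
  have "generate_topology_on S U"
    using assms(1) unfolding initial_topology_def S_def by (rule openin_topology_generated_by)
  then have "\<forall>x\<in>U. \<exists>J \<epsilon>. finite J \<and> J \<subseteq> I \<and> \<epsilon> > 0 \<and>
    (\<forall>y\<in>X. (\<forall>i\<in>J. dist (e i y) (e i x) < \<epsilon>) \<longrightarrow> y \<in> U)"
  proof (induction rule: generate_topology_on.induct)
    case (Int a b)
    show ?case
    proof
      fix x assume "x \<in> a \<inter> b"
      then have x: "x \<in> a" "x \<in> b" by auto
      obtain J \<epsilon> where "finite J" "J \<subseteq> I" "\<epsilon> > 0"
        "\<forall>y\<in>X. (\<forall>i\<in>J. dist (e i y) (e i x) < \<epsilon>) \<longrightarrow> y \<in> a"
        using Int.IH(1)[rule_format, OF x(1)] by blast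
      moreover obtain J' \<epsilon>' where "finite J'" "J' \<subseteq> I" "\<epsilon>' > 0"
        "\<forall>y\<in>X. (\<forall>i\<in>J'. dist (e i y) (e i x) < \<epsilon>') \<longrightarrow> y \<in> b"
        using Int.IH(2)[rule_format, OF x(2)] by blast
      ultimately show "\<exists>J \<epsilon>. finite J \<and> J \<subseteq> I \<and> \<epsilon> > 0 \<and>
          (\<forall>y\<in>X. (\<forall>i\<in>J. dist (e i y) (e i x) < \<epsilon>) \<longrightarrow> y \<in> a \<inter> b)"
        by (intro exI[of _ "J \<union> J'"] exI[of _ "min \<epsilon> \<epsilon>'"]) simp
    qed
  next
    case (UN K)
    show ?case
    proof
      fix x assume "x \<in> \<Union>K"
      then obtain k where k: "k \<in> K" "x \<in> k" by blast
      then obtain J \<epsilon> where "finite J" "J \<subseteq> I" "\<epsilon> > 0"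
        "\<forall>y\<in>X. (\<forall>i\<in>J. dist (e i y) (e i x) < \<epsilon>) \<longrightarrow> y \<in> k"
        using UN.IH[OF k(1), rule_format, OF k(2)] by blast
      then show "\<exists>J \<epsilon>. finite J \<and> J \<subseteq> I \<and> \<epsilon> > 0 \<and>
          (\<forall>y\<in>X. (\<forall>i\<in>J. dist (e i y) (e i x) < \<epsilon>) \<longrightarrow> y \<in> \<Union>K)"
        using k(1) by (intro exI[of _ J] exI[of _ \<epsilon>]) blast
    qed
  next
    case (Basis s)
    then obtain i V where s: "s = {x \<in> X. e i x \<in> V}" "i \<in> I" "open V" by (auto simp: S_def)
    show ?case
    proof
      fix x assume "x \<in> s"
      then obtain \<epsilon> where "\<epsilon> > 0" "\<forall>z. dist z (e i x) < \<epsilon> \<longrightarrow> z \<in> V"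
        using s by (auto simp: open_dist)
      then show "\<exists>J \<epsilon>. finite J \<and> J \<subseteq> I \<and> \<epsilon> > 0 \<and>
          (\<forall>y\<in>X. (\<forall>i\<in>J. dist (e i y) (e i x) < \<epsilon>) \<longrightarrow> y \<in> s)"
        using s by (intro exI[of _ "{i}"] exI[of _ \<epsilon>]) auto
    qed
  qed auto
  then have "\<exists>J \<epsilon>. finite J \<and> J \<subseteq> I \<and> \<epsilon> > 0 \<and>
    (\<forall>y\<in>X. (\<forall>i\<in>J. dist (e i y) (e i x) < \<epsilon>) \<longrightarrow> y \<in> U)"
    using assms(2) by (rule bspec)
  then show thesis using that by auto
qed

lemma Hausdorff_initial_topology:
  fixes e :: "'i \<Rightarrow> 'x \<Rightarrow> 'c::t2_space"
  assumes "\<And>x y. x \<in> X \<Longrightarrow> y \<in> X \<Longrightarrow> (\<And>i. i \<in> I \<Longrightarrow> e i x = e i y) \<Longrightarrow> x = y" "I \<noteq> {}"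
  shows "Hausdorff_space (initial_topology X I e)"
  unfolding Hausdorff_space_def topspace_initial_topology[OF assms(2)]
proof (intro allI impI, elim conjE)
  fix x y assume xy: "x \<in> X" "y \<in> X" "x \<noteq> y"
  then obtain i where i: "i \<in> I" "e i x \<noteq> e i y" using assms(1) by blast
  then obtain U V where UV: "open U" "open V" "e i x \<in> U" "e i y \<in> V" "U \<inter> V = {}"
    using hausdorff[OF i(2)] by blast
  have "openin (initial_topology X I e) {x \<in> X. e i x \<in> W}" if "open W" for W
    unfolding initial_topology_def by (rule topology_generated_by_Basis) (use i(1) that in blast)
  then show "\<exists>U V. openin (initial_topology X I e) U \<and> openin (initial_topology X I e) V \<and>
      x \<in> U \<and> y \<in> V \<and> disjnt U V"
    using UV xy by (intro exI[of _ "{x \<in> X. e i x \<in> U}"] exI[of _ "{x \<in> X. e i x \<in> V}"])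
      (auto simp: disjnt_def)
qed

section \<open>Duals and biduals\<close>

lemma weak_topology_dual_initial:
  "weak_topology_dual scl = initial_topology (dual scl) (bidual scl) (\<lambda>F f. F f)"
  by (simp add: weak_topology_dual_def initial_topology_def)

lemma weak_star_topology_bidual_initial:
  "weak_star_topology_bidual scl = initial_topology (bidual scl) (dual scl) (\<lambda>f F. F f)"
  by (simp add: weak_star_topology_bidual_def initial_topology_def)

lemma dual_scaleI: "f \<in> dual scl \<Longrightarrow> f (scl c x) = c * f x"
  by (simp add: dual_def)

lemma zero_in_dual: "0 \<in> dual scl"
  by (simp add: dual_def)

lemma add_in_dual: "f \<in> dual scl \<Longrightarrow> g \<in> dual scl \<Longrightarrow> f + g \<in> dual scl"
  by (simp add: dual_def blinfun.bilinear_simps algebra_simps)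

lemma dual_scale_in_dual: "f \<in> dual scl \<Longrightarrow> dual_scale c f \<in> dual scl"
  by (simp add: dual_def)

lemma sum_in_dual: "(\<And>j. j \<in> J \<Longrightarrow> f j \<in> dual scl) \<Longrightarrow> sum f J \<in> dual scl"
  by (induction J rule: infinite_finite_induct) (auto intro: zero_in_dual add_in_dual)

lemma
  assumes "F \<in> bidual scl"
  shows bidual_add: "f \<in> dual scl \<Longrightarrow> g \<in> dual scl \<Longrightarrow> F (f + g) = F f + F g"
    and bidual_dual_scale: "f \<in> dual scl \<Longrightarrow> F (dual_scale c f) = c * F f"
    and bidual_extensional: "F \<in> extensional (dual scl)"
    and bidual_zero: "F 0 = 0"
proof -
  show *: "F (dual_scale c f) = c * F f" if "f \<in> dual scl" for c f
    using assms that by (simp add: bidual_def dual_of_subspace_def)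
  show "F 0 = 0"
    using *[OF zero_in_dual, of 0] by (simp add: dual_scale_def)
qed (use assms in \<open>auto simp: bidual_def dual_of_subspace_def\<close>)

text \<open>Positivity is arranged because the constant later becomes the radius of a ball and a
  divisor.\<close>

lemma bidual_bound:
  assumes "F \<in> bidual scl"
  obtains K where "K > 0" "\<And>f. f \<in> dual scl \<Longrightarrow> norm (F f) \<le> K * norm f"
proof -
  obtain K where K: "\<forall>f\<in>dual scl. norm (F f) \<le> K * norm f"
    using assms unfolding bidual_def dual_of_subspace_def by blast
  have "norm (F f) \<le> max K 1 * norm f" if "f \<in> dual scl" for f
    using K that by (meson max.cobounded1 mult_right_mono norm_ge_zero order_trans)
  then show thesis by (intro that[of "max K 1"]) auto
qed

lemma bidualI:
  assumes "F \<in> extensional (dual scl)"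
    and "\<And>f g. f \<in> dual scl \<Longrightarrow> g \<in> dual scl \<Longrightarrow> F (f + g) = F f + F g"
    and "\<And>c f. f \<in> dual scl \<Longrightarrow> F (dual_scale c f) = c * F f"
    and "\<And>f. f \<in> dual scl \<Longrightarrow> norm (F f) \<le> K * norm f"
  shows "F \<in> bidual scl"
  using assms unfolding bidual_def dual_of_subspace_def by blast

lemma bidual_sum:
  assumes "F \<in> bidual scl" "\<And>j. j \<in> J \<Longrightarrow> f j \<in> dual scl"
  shows "F (sum f J) = (\<Sum>j\<in>J. F (f j))"
  using assms(2)
  by (induction J rule: infinite_finite_induct)
    (auto simp: bidual_zero[OF assms(1)] bidual_add[OF assms(1)] sum_in_dual)

text \<open>The canonical embedding of a space into its bidual; \<open>restrict\<close> makes the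
  values extensional, as \<open>bidual\<close> demands.\<close>

definition bidual_eval :: "('k \<Rightarrow> 'v \<Rightarrow> 'v) \<Rightarrow> 'v \<Rightarrow>
    ('v::real_normed_vector \<Rightarrow>\<^sub>L 'k::real_normed_field) \<Rightarrow> 'k" where
  "bidual_eval scl x = restrict (\<lambda>f. blinfun_apply f x) (dual scl)"

lemma bidual_eval_apply: "f \<in> dual scl \<Longrightarrow> bidual_eval scl x f = f x"
  by (simp add: bidual_eval_def)

lemma norm_bidual_eval_le: "f \<in> dual scl \<Longrightarrow> norm (bidual_eval scl x f) \<le> norm x * norm f"
  using norm_blinfun[of f x] by (simp add: bidual_eval_apply mult.commute)

lemma bidual_eval_in_bidual: "bidual_eval scl x \<in> bidual scl"
proof (rule bidualI[where K = "norm x"])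
  show "bidual_eval scl x \<in> extensional (dual scl)" by (simp add: bidual_eval_def)
qed (simp_all only: norm_bidual_eval_le, simp_all add: bidual_eval_apply add_in_dual dual_scale_in_dual
  blinfun.bilinear_simps)

lemma topspace_weak_topology_dual: "topspace (weak_topology_dual scl) = dual scl"
  unfolding weak_topology_dual_initial using bidual_eval_in_bidual[of scl 0]
  by (intro topspace_initial_topology) auto

lemma topspace_weak_star_topology_bidual: "topspace (weak_star_topology_bidual scl) = bidual scl"
  unfolding weak_star_topology_bidual_initial using zero_in_dual[of scl]
  by (intro topspace_initial_topology) auto

lemma Hausdorff_weak_topology_dual: "Hausdorff_space (weak_topology_dual scl)"
  unfolding weak_topology_dual_initial
proof (rule Hausdorff_initial_topology)
  fix f g assume "f \<in> dual scl" "g \<in> dual scl" "\<And>F. F \<in> bidual scl \<Longrightarrow> F f = F g"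
  then show "f = g"
    using bidual_eval_in_bidual by (metis bidual_eval_apply blinfun_eqI)
qed (use bidual_eval_in_bidual in blast)

lemma continuous_map_weak_eval:
  "F \<in> bidual scl \<Longrightarrow> continuous_map (weak_topology_dual scl) euclidean F"
  unfolding weak_topology_dual_initial by (rule continuous_map_initial_eval)

lemma continuous_map_weak_star_eval:
  "f \<in> dual scl \<Longrightarrow> continuous_map (weak_star_topology_bidual scl) euclidean (\<lambda>F. F f)"
  unfolding weak_star_topology_bidual_initial
  by (rule continuous_map_initial_eval[where e = "\<lambda>f F. F f"])

section \<open>Helly's lemma\<close>

text \<open>The functional \<open>z \<mapsto> 1 \<bullet> z\<close> stands in for the real part, so
  every real-linear functional on the field is the real part of a multiplication. The map
  \<open>h\<close> from \<open>c\<close> to the vector representing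
  \<open>z \<mapsto> 1 \<bullet> (c * z)\<close> is injective, as \<open>z = inverse c\<close>
  shows, and therefore surjective in finite dimension.\<close>

lemma inner_eq_inner_one_mult:
  fixes w :: "'k::{real_normed_field,euclidean_space}"
  obtains c where "\<And>z. w \<bullet> z = 1 \<bullet> (c * z)"
proof -
  define h where "h c = (\<Sum>b\<in>Basis. (1 \<bullet> (c * b)) *\<^sub>R b)" for c :: 'k
  have h: "h c \<bullet> z = 1 \<bullet> (c * z)" for c z
  proof -
    have "h c \<bullet> z = (\<Sum>b\<in>Basis. (1 \<bullet> (c * b)) * (b \<bullet> z))"
      by (simp add: h_def inner_sum_left)
    also have "\<dots> = 1 \<bullet> (c * (\<Sum>b\<in>Basis. (z \<bullet> b) *\<^sub>R b))"
      by (simp add: sum_distrib_left inner_sum_right inner_commute mult.commute)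
    finally show ?thesis by (simp add: euclidean_representation)
  qed
  have "linear h"
    by (rule linearI) (auto simp: h_def algebra_simps sum.distrib inner_add_right scaleR_sum_right)
  moreover have "inj h"
    unfolding linear_injective_0[OF \<open>linear h\<close>]
  proof (intro allI impI, rule ccontr)
    fix c assume c: "h c = 0" "c \<noteq> 0"
    show False using h[of c "inverse c"] c by simp
  qed
  ultimately have "surj h" by (intro linear_injective_imp_surjective) auto
  then obtain c where "w = h c" by blast
  then show thesis using h that by blast
qed

text \<open>
  A near-minimiser \<open>x\<close> of the squared distance \<open>\<Sum>|F f - f x|\<^sup>2\<close> over the ball replaces the
  separating hyperplane: the gradient at \<open>x\<close> gives a functional \<open>\<phi>\<close> with \<open>|F \<phi>| > K |\<phi>|\<close>,
  unless the distance is small.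
\<close>

lemma helly:
  fixes scl :: "'k::{real_normed_field,euclidean_space} \<Rightarrow> 'v::real_normed_vector \<Rightarrow> 'v"
  assumes X: "normed_space_over scl" and F: "F \<in> bidual scl"
    and K: "K > 0" "\<And>f. f \<in> dual scl \<Longrightarrow> norm (F f) \<le> K * norm f"
    and J: "finite J" "J \<subseteq> dual scl" and \<epsilon>: "\<epsilon> > 0"
  obtains x where "norm x \<le> K" "\<And>f. f \<in> J \<Longrightarrow> norm (blinfun_apply f x - F f) < \<epsilon>"
proof (rule ccontr)
  assume "\<not> thesis"
  then have far: "\<exists>f\<in>J. norm (blinfun_apply f x - F f) \<ge> \<epsilon>" if "norm x \<le> K" for x
    using that \<open>\<And>x. norm x \<le> K \<Longrightarrow> (\<And>f. f \<in> J \<Longrightarrow> norm (blinfun_apply f x - F f) < \<epsilon>) \<Longrightarrow> thesis\<close>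
    by (meson not_le)
  define B where "B = {x :: 'v. norm x \<le> K}"
  define D where "D x = (\<Sum>f\<in>J. (norm (F f - blinfun_apply f x))\<^sup>2)" for x :: 'v
  \<comment> \<open>\<open>M\<close> bounds the second-order coefficient of \<open>D\<close> along
    segments of the ball, whose points are at most \<open>2 * K\<close> apart. The step length
    \<open>t\<close> is chosen to make \<open>t * M\<close> smaller than
    \<open>\<epsilon>\<^sup>2\<close>, the lower bound of \<open>D\<close> on the ball.\<close>
  define M where "M = (\<Sum>f\<in>J. (2 * K * norm f)\<^sup>2)"
  define t where "t = \<epsilon>\<^sup>2 / (M + \<epsilon>\<^sup>2 + 1)"
  have M0: "M \<ge> 0" by (auto simp: M_def intro: sum_nonneg)
  have t: "0 < t" "t \<le> 1" "t * M < \<epsilon>\<^sup>2"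
  proof -
    have "M + \<epsilon>\<^sup>2 + 1 > 0" using M0 by (simp add: add_nonneg_pos)
    then show "0 < t" "t \<le> 1" "t * M < \<epsilon>\<^sup>2"
      using M0 \<epsilon> by (auto simp: t_def field_simps add_pos_nonneg)
  qed
  have D_far: "D x \<ge> \<epsilon>\<^sup>2" if x: "x \<in> B" for x
  proof -
    obtain f where f: "f \<in> J" "norm (f x - F f) \<ge> \<epsilon>" using far[of x] x by (auto simp: B_def)
    have "\<epsilon>\<^sup>2 \<le> (norm (F f - f x))\<^sup>2"
      using f \<epsilon> by (intro power_mono) (auto simp: norm_minus_commute)
    also have "\<dots> \<le> D x"
      unfolding D_def using f J(1) by (intro member_le_sum) auto
    finally show ?thesis .
  qed
  \<comment> \<open>The infimum need not be attained. The tolerance is proportional to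
    \<open>t\<close>, so that dividing by \<open>t\<close> later leaves a constant.\<close>
  obtain x where x: "x \<in> B" and min: "\<And>z. z \<in> B \<Longrightarrow> D x \<le> D z + t * \<epsilon>\<^sup>2"
  proof -
    have ne: "D ` B \<noteq> {}" using K(1) by (auto simp: B_def intro: exI[of _ 0])
    have bdd: "bdd_below (D ` B)" using D_far by (intro bdd_belowI[of _ "\<epsilon>\<^sup>2"]) auto
    have "Inf (D ` B) < Inf (D ` B) + t * \<epsilon>\<^sup>2" using t \<epsilon> by simp
    then obtain x where "x \<in> B" "D x < Inf (D ` B) + t * \<epsilon>\<^sup>2"
      using cInf_lessD[OF ne] by blast
    moreover have "Inf (D ` B) \<le> D z" if "z \<in> B" for z
      using bdd that by (simp add: cINF_lower)
    ultimately show thesis by (intro that[of x]) (auto intro: order_trans[OF less_imp_le add_right_mono])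
  qed
  define w where "w f = F f - blinfun_apply f x" for f
  have "\<forall>f. \<exists>c. \<forall>z. w f \<bullet> z = 1 \<bullet> (c * z)"
    by (metis inner_eq_inner_one_mult)
  then obtain c where c: "\<And>f z. w f \<bullet> z = 1 \<bullet> (c f * z)" by metis
  \<comment> \<open>The scalars \<open>c f\<close> turn the real pairings with \<open>w f\<close>
    into real parts of products. Thus \<open>\<phi>\<close> is linear over the field, and its real
    part is the derivative of \<open>D\<close> at \<open>x\<close> up to the factor -2.\<close>
  define \<phi> where "\<phi> = (\<Sum>f\<in>J. dual_scale (c f) f)"
  have \<phi>: "\<phi> \<in> dual scl"
    unfolding \<phi>_def using J by (intro sum_in_dual dual_scale_in_dual) auto
  have in1: "1 \<bullet> \<phi> y = (\<Sum>f\<in>J. w f \<bullet> f y)" for y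
    by (simp add: \<phi>_def blinfun.sum_left inner_sum_right c)
  have "F \<phi> = (\<Sum>f\<in>J. c f * F f)"
    unfolding \<phi>_def using J
    by (subst bidual_sum[OF F]) (auto intro!: dual_scale_in_dual sum.cong bidual_dual_scale[OF F])
  then have in2: "1 \<bullet> F \<phi> = (\<Sum>f\<in>J. w f \<bullet> F f)"
    by (simp add: inner_sum_right c)
  have DD: "1 \<bullet> F \<phi> - 1 \<bullet> \<phi> x = D x"
    by (simp add: in1 in2 D_def w_def power2_norm_eq_inner inner_diff_right flip: sum_subtractf)
  \<comment> \<open>A move of length \<open>t\<close> from \<open>x\<close> towards \<open>y\<close>
    stays in the convex ball and cannot lower \<open>D\<close> by more than the tolerance, which
    limits the derivative in the direction \<open>y - x\<close>.\<close>
  have step: "1 \<bullet> \<phi> y \<le> 1 \<bullet> \<phi> x + (t * M + \<epsilon>\<^sup>2) / 2" if y: "y \<in> B" for y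
  proof -
    define z where "z = (1 - t) *\<^sub>R x + t *\<^sub>R y"
    have "norm z \<le> (1 - t) * norm x + t * norm y"
      unfolding z_def by (rule norm_triangle_le) (use t in auto)
    also have "\<dots> \<le> (1 - t) * K + t * K"
      using x y t by (intro add_mono mult_left_mono) (auto simp: B_def)
    finally have "z \<in> B" by (simp add: B_def algebra_simps)
    have "(norm (F f - blinfun_apply f z))\<^sup>2 = (norm (F f - f x))\<^sup>2 - 2 * t * (w f \<bullet> f y - w f \<bullet> f x)
        + t\<^sup>2 * (norm (f y - f x))\<^sup>2" for f
    proof -
      have "F f - f z = w f - t *\<^sub>R (f y - f x)"
        by (simp add: w_def z_def blinfun.bilinear_simps algebra_simps)
      moreover have "(norm (w f - t *\<^sub>R (f y - f x)))\<^sup>2 =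
          (norm (w f))\<^sup>2 - 2 * t * (w f \<bullet> (f y - f x)) + t\<^sup>2 * (norm (f y - f x))\<^sup>2"
        unfolding power2_norm_eq_inner by (simp add: inner_diff inner_commute power2_eq_square algebra_simps)
      ultimately show ?thesis by (simp only: w_def inner_diff_right)
    qed
    then have Dz: "D z = D x - 2 * t * (1 \<bullet> \<phi> y - 1 \<bullet> \<phi> x) + t\<^sup>2 * (\<Sum>f\<in>J. (norm (blinfun_apply f y - f x))\<^sup>2)"
      unfolding D_def in1 by (simp add: sum.distrib sum_subtractf sum_distrib_left right_diff_distrib)
    have "(\<Sum>f\<in>J. (norm (blinfun_apply f y - f x))\<^sup>2) \<le> M"
      unfolding M_def
    proof (intro sum_mono power_mono)
      fix f :: "'v \<Rightarrow>\<^sub>L 'k"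
      have "norm (f y - f x) = norm (f (y - x))" by (simp add: blinfun.diff_right)
      also have "\<dots> \<le> norm f * norm (y - x)" by (rule norm_blinfun)
      also have "\<dots> \<le> norm f * (2 * K)"
        using x y norm_triangle_ineq4[of y x] by (intro mult_left_mono) (auto simp: B_def)
      finally show "norm (f y - f x) \<le> 2 * K * norm f" by (simp add: mult.commute)
    qed auto
    then have "t\<^sup>2 * (\<Sum>f\<in>J. (norm (blinfun_apply f y - f x))\<^sup>2) \<le> t\<^sup>2 * M"
      by (intro mult_left_mono) auto
    then have "2 * t * (1 \<bullet> \<phi> y - 1 \<bullet> \<phi> x) \<le> t\<^sup>2 * M + t * \<epsilon>\<^sup>2"
      using min[OF \<open>z \<in> B\<close>] Dz by linarith
    also have "\<dots> = t * (t * M + \<epsilon>\<^sup>2)" by (simp add: power2_eq_square algebra_simps)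
    finally have "2 * (1 \<bullet> \<phi> y - 1 \<bullet> \<phi> x) \<le> t * M + \<epsilon>\<^sup>2"
      using t(1) by (simp add: mult.assoc mult.left_commute)
    then show ?thesis by (simp add: field_simps)
  qed
  define R where "R = 1 \<bullet> \<phi> x + (t * M + \<epsilon>\<^sup>2) / 2"
  interpret normed_space_over scl by (rule X)
  have one: "(1::'k) \<bullet> 1 = 1" by (simp add: dot_square_norm)
  \<comment> \<open>A unimodular multiple of \<open>y\<close> makes the value of
    \<open>\<phi>\<close> real and nonnegative, so the bound on real parts becomes a bound on
    norms.\<close>
  have R: "norm (\<phi> y) \<le> R" if y: "y \<in> B" for y
  proof (cases "\<phi> y = 0")
    case True
    then show ?thesis using step[OF y] by (simp add: R_def)
  next
    case False
    define u where "u = of_real (norm (\<phi> y)) / \<phi> y"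
    have "norm u = 1" using False by (simp add: u_def norm_divide)
    then have "scl u y \<in> B" using y by (simp add: B_def norm_scale)
    moreover have "\<phi> (scl u y) = norm (\<phi> y) *\<^sub>R 1"
      using False by (simp add: dual_scaleI[OF \<phi>] u_def scaleR_conv_of_real)
    ultimately show ?thesis using step[of "scl u y"] one by (simp add: R_def)
  qed
  have "norm \<phi> \<le> R / K"
  proof (rule norm_blinfun_bound)
    show "R / K \<ge> 0" using R[of 0] K(1) by (auto simp: B_def blinfun.zero_right)
    fix y
    show "norm (\<phi> y) \<le> R / K * norm y"
    proof (cases "y = 0")
      case False
      have "norm (\<phi> ((K / norm y) *\<^sub>R y)) \<le> R" using K(1) False by (intro R) (auto simp: B_def)
      then show ?thesis using K(1) False by (simp add: blinfun.scaleR_right field_simps)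
    qed (simp add: blinfun.zero_right)
  qed
  then have "K * norm \<phi> \<le> R" using K(1) by (simp add: field_simps)
  moreover have "1 \<bullet> F \<phi> \<le> norm (F \<phi>)" using norm_cauchy_schwarz[of 1 "F \<phi>"] by simp
  \<comment> \<open>The chain \<open>1 \<bullet> F \<phi> \<le> norm (F \<phi>) \<le> K * norm
    \<phi> \<le> R\<close> bounds \<open>D x\<close>; by the choice of \<open>t\<close> the bound
    lies below \<open>\<epsilon>\<^sup>2\<close>.\<close>
  ultimately have "D x \<le> (t * M + \<epsilon>\<^sup>2) / 2"
    using K(2)[OF \<phi>] DD unfolding R_def by linarith
  then show False using D_far[OF x] t(3) by (simp add: field_simps)
qed

section \<open>The Banach--Alaoglu theorem\<close>

text \<open>By Tychonoff's theorem the product of the discs \<open>cball 0 (norm f)\<close> is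
  compact, the field being finite-dimensional over the reals. The linear functionals are closed in
  it, since each linearity equation involves finitely many coordinates.\<close>

lemma compactin_bidual_ball:
  fixes scl :: "'k::{real_normed_field,euclidean_space} \<Rightarrow> 'v::real_normed_vector \<Rightarrow> 'v"
  shows "compactin (weak_star_topology_bidual scl)
    {F \<in> bidual scl. \<forall>f\<in>dual scl. norm (F f) \<le> norm f}" (is "compactin _ ?B")
proof -
  define P where "P = product_topology (\<lambda>f :: 'v \<Rightarrow>\<^sub>L 'k. euclidean :: 'k topology) (dual scl)"
  have top: "topspace P = extensional (dual scl)"
    by (simp add: P_def PiE_def)
  have ev: "continuous_map P euclidean (\<lambda>F. F f)" if "f \<in> dual scl" for f
    unfolding P_def by (rule continuous_map_product_projection[OF that])
  have B_eq: "?B = (\<Pi>\<^sub>E f\<in>dual scl. cball 0 (norm f)) \<inter>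
      (topspace P \<inter>
       (\<Inter>(f, g)\<in>dual scl \<times> dual scl. {F \<in> topspace P. F (f + g) - (F f + F g) \<in> {0}}) \<inter>
       (\<Inter>(c, f)\<in>UNIV \<times> dual scl. {F \<in> topspace P. F (dual_scale c f) - c * F f \<in> {0}}))" (is "_ = ?C \<inter> ?D")
  proof (intro equalityI subsetI)
    fix F assume F: "F \<in> ?B"
    then have "F \<in> bidual scl" by simp
    note F' = bidual_extensional[OF this] bidual_add[OF this] bidual_dual_scale[OF this]
    then show "F \<in> ?C \<inter> ?D" using F by (auto simp: PiE_def top)
  next
    fix F assume F: "F \<in> ?C \<inter> ?D"
    then have ext: "F \<in> extensional (dual scl)" by (simp add: PiE_def)
    have bd: "norm (F f) \<le> norm f" if "f \<in> dual scl" for f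
      using F that by (auto simp: PiE_def Pi_def)
    have "F \<in> bidual scl"
    proof (rule bidualI[where K = 1])
      show "F (f + g) = F f + F g" if "f \<in> dual scl" "g \<in> dual scl" for f g
        using F that by fastforce
      show "F (dual_scale c f) = c * F f" if "f \<in> dual scl" for c f
        using F that by fastforce
    qed (use ext bd in auto)
    then show "F \<in> ?B" using bd by simp
  qed
  have add: "closedin P {F \<in> topspace P. F (f + g) - (F f + F g) \<in> {0}}"
    if "f \<in> dual scl" "g \<in> dual scl" for f g
    by (rule closedin_continuous_map_preimage[where Y = euclidean])
      (use that in \<open>auto intro!: continuous_map_diff continuous_map_add ev add_in_dual\<close>)
  have scale: "closedin P {F \<in> topspace P. F (dual_scale c f) - c * F f \<in> {0}}"
    if "f \<in> dual scl" for c f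
  proof (rule closedin_continuous_map_preimage[where Y = euclidean])
    have "continuous_map P euclidean ((\<lambda>z. c * z) \<circ> (\<lambda>F. F f))"
      by (rule continuous_map_compose[OF ev[OF that]]) (auto intro: continuous_intros)
    then show "continuous_map P euclidean (\<lambda>F. F (dual_scale c f) - c * F f)"
      using that by (intro continuous_map_diff ev dual_scale_in_dual) (auto simp: o_def)
  qed simp
  have "closedin P ?D"
  proof (intro closedin_Int closedin_INT closedin_topspace)
    show "dual scl \<times> dual scl \<noteq> {}" "(UNIV :: 'k set) \<times> dual scl \<noteq> {}"
      using zero_in_dual[of scl] by auto
  qed (use add scale in \<open>auto simp only: split: prod.split\<close>)
  moreover have "compactin P ?C"
    unfolding P_def compactin_PiE by auto
  ultimately have "compactin P ?B"
    unfolding B_eq by (simp add: compact_Int_closedin)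
  then have "compactin (subtopology P ?B) ?B"
    by (simp add: compactin_subtopology)
  \<comment> \<open>The identity carries compactness from the product topology to the weak-star
    topology.\<close>
  moreover have "continuous_map (subtopology P ?B) (weak_star_topology_bidual scl) (\<lambda>F. F)"
    unfolding weak_star_topology_bidual_initial
    by (rule continuous_map_into_initial_topology)
      (use zero_in_dual[of scl] in \<open>auto intro: continuous_map_from_subtopology ev\<close>)
  ultimately have "compactin (weak_star_topology_bidual scl) ((\<lambda>F. F) ` ?B)"
    by (rule image_compactin)
  then show ?thesis by simp
qed

section \<open>Gantmacher's theorem for operators into a dual\<close>

text \<open>\<open>S\<close> is the adjoint of \<open>T : X \<rightarrow> Y\<^sup>*\<close>; linearity of \<open>T\<close> is implied by its existence.\<close>

locale operator_into_dual =
  X: normed_space_over scaleX + Y: normed_space_over scaleY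
  for scaleX :: "'k::{real_normed_field,euclidean_space} \<Rightarrow> 'x::real_normed_vector \<Rightarrow> 'x"
    and scaleY :: "'k \<Rightarrow> 'y::real_normed_vector \<Rightarrow> 'y" +
  fixes T :: "'x \<Rightarrow> 'y \<Rightarrow>\<^sub>L 'k" and S :: "(('y \<Rightarrow>\<^sub>L 'k) \<Rightarrow> 'k) \<Rightarrow> 'x \<Rightarrow>\<^sub>L 'k" and C :: real
  assumes T_in_dual: "T x \<in> dual scaleY"
    and T_bound: "norm (T x) \<le> C * norm x"
    and C_nonneg: "C \<ge> 0"
    and S_in_dual: "G \<in> bidual scaleY \<Longrightarrow> S G \<in> dual scaleX"
    and S_apply: "G \<in> bidual scaleY \<Longrightarrow> S G x = G (T x)"
begin

text \<open>The second adjoint of \<open>T\<close> sends \<open>F\<close> to \<open>K\<close> times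
  a point of the compact set. By Helly's lemma, points \<open>T (x / K)\<close> with
  \<open>norm x \<le> K\<close> satisfy any finite number of the required equations approximately;
  these conditions are weakly closed, so compactness yields one \<open>g\<close> satisfying all of
  them exactly.\<close>

lemma weakly_compact_imp_bitranspose_value:
  assumes comp: "compactin (weak_topology_dual scaleY)
      (weak_topology_dual scaleY closure_of {T x | x. norm x \<le> 1})"
    and F: "F \<in> bidual scaleX"
  obtains g K where "g \<in> dual scaleY" "\<And>G. G \<in> bidual scaleY \<Longrightarrow> F (S G) = K *\<^sub>R G g"
proof -
  let ?W = "weak_topology_dual scaleY"
  let ?M = "?W closure_of {T x | x. norm x \<le> 1}"
  obtain K where K: "K > 0" "\<And>f. f \<in> dual scaleX \<Longrightarrow> norm (F f) \<le> K * norm f"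
    using bidual_bound[OF F] by blast
  define V where "V G \<epsilon> = {g \<in> topspace ?W. K *\<^sub>R G g - F (S G) \<in> cball 0 \<epsilon>}" for G \<epsilon>
  define \<V> where "\<V> = {V G \<epsilon> | G \<epsilon>. G \<in> bidual scaleY \<and> \<epsilon> > 0}"
  have "closedin ?W (V G \<epsilon>)" if "G \<in> bidual scaleY" for G \<epsilon>
    unfolding V_def
  proof (rule closedin_continuous_map_preimage[where Y = euclidean])
    have "continuous_map ?W euclidean ((\<lambda>z. K *\<^sub>R z - F (S G)) \<circ> G)"
      by (rule continuous_map_compose[OF continuous_map_weak_eval[OF that]])
        (auto intro!: continuous_intros)
    then show "continuous_map ?W euclidean (\<lambda>g. K *\<^sub>R G g - F (S G))" by (simp add: o_def)
  qed simp
  then have closed: "\<forall>N\<in>\<V>. closedin ?W N" by (auto simp: \<V>_def)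
  have fip: "?M \<inter> \<Inter>\<F> \<noteq> {}" if \<F>: "finite \<F>" "\<F> \<subseteq> \<V>" for \<F>
  proof -
    have "\<forall>N\<in>\<F>. \<exists>G \<epsilon>. N = V G \<epsilon> \<and> G \<in> bidual scaleY \<and> \<epsilon> > 0"
      using \<F>(2) by (auto simp: \<V>_def)
    then obtain G \<epsilon> where G: "\<And>N. N \<in> \<F> \<Longrightarrow> N = V (G N) (\<epsilon> N)"
      "\<And>N. N \<in> \<F> \<Longrightarrow> G N \<in> bidual scaleY" "\<And>N. N \<in> \<F> \<Longrightarrow> \<epsilon> N > 0"
      by metis
    \<comment> \<open>The inserted \<open>1\<close> keeps the minimum meaningful when
      \<open>\<F>\<close> is empty.\<close>
    define \<delta> where "\<delta> = Min (insert 1 (\<epsilon> ` \<F>))"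
    have \<delta>: "\<delta> > 0" "\<And>N. N \<in> \<F> \<Longrightarrow> \<delta> \<le> \<epsilon> N"
      using \<F>(1) G(3) by (auto simp: \<delta>_def)
    obtain x where x: "norm x \<le> K" "\<And>f. f \<in> (\<lambda>N. S (G N)) ` \<F> \<Longrightarrow> norm (blinfun_apply f x - F f) < \<delta>"
      using helly[OF X.normed_space_over_axioms F K, of "(\<lambda>N. S (G N)) ` \<F>" \<delta>] \<F>(1) \<delta>(1) G(2) S_in_dual
      by (metis (no_types, lifting) finite_imageI image_subsetI)
    \<comment> \<open>Division by \<open>K\<close> brings \<open>x\<close> into the unit ball and
      causes the factor \<open>K\<close> in the conclusion.\<close>
    define g where "g = T ((1 / K) *\<^sub>R x)"
    have "g \<in> {T x | x. norm x \<le> 1}"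
      unfolding g_def using x(1) K(1) by (intro CollectI exI[of _ "(1 / K) *\<^sub>R x"]) auto
    also have "\<dots> \<subseteq> ?M"
      by (rule closure_of_subset) (auto simp: topspace_weak_topology_dual T_in_dual)
    finally have "g \<in> ?M" .
    moreover have "g \<in> N" if N: "N \<in> \<F>" for N
    proof -
      have "K *\<^sub>R G N g = S (G N) x"
        using K(1) unfolding g_def S_apply[OF G(2)[OF N], symmetric] by (simp add: blinfun.scaleR_right)
      moreover have "norm (S (G N) x - F (S (G N))) < \<delta>" by (rule x(2)) (use N in blast)
      ultimately have "norm (K *\<^sub>R G N g - F (S (G N))) \<le> \<epsilon> N"
        using \<delta>(2)[OF N] by simp
      then show ?thesis
        by (subst G(1)[OF N]) (simp add: V_def topspace_weak_topology_dual g_def T_in_dual)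
    qed
    ultimately show ?thesis by blast
  qed
  have "?M \<inter> \<Inter>\<V> \<noteq> {}"
    using comp closed fip unfolding compactin_fip by blast
  then obtain g where g: "g \<in> ?M" "\<And>N. N \<in> \<V> \<Longrightarrow> g \<in> N" by blast
  show thesis
  proof (rule that[of g K])
    show "g \<in> dual scaleY"
      using g(1) closure_of_subset_topspace[of ?W] by (auto simp: topspace_weak_topology_dual)
    fix G assume G: "G \<in> bidual scaleY"
    have "norm (K *\<^sub>R G g - F (S G)) \<le> 0 + \<epsilon>" if "\<epsilon> > 0" for \<epsilon>
      using g(2)[of "V G \<epsilon>"] G that by (auto simp: \<V>_def V_def)
    then have "norm (K *\<^sub>R G g - F (S G)) \<le> 0" by (rule field_le_epsilon)
    then show "F (S G) = K *\<^sub>R G g" by simp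
  qed
qed

text \<open>
  The values of \<open>g\<close> are forced on the canonical image of \<open>Y\<close>, which is weak-star dense in the
  bidual by Helly's lemma.
\<close>

lemma weak_star_continuous_imp_bitranspose_value:
  assumes cont: "continuous_map (weak_star_topology_bidual scaleY) euclidean (\<lambda>G. F (S G))"
    and F: "F \<in> bidual scaleX"
  obtains g where "g \<in> dual scaleY" "\<And>G. G \<in> bidual scaleY \<Longrightarrow> F (S G) = G g"
proof -
  let ?W = "weak_star_topology_bidual scaleY"
  let ?j = "bidual_eval scaleY"
  note J = bidual_eval_in_bidual[of scaleY]
  obtain K where K: "K > 0" "\<And>f. f \<in> dual scaleX \<Longrightarrow> norm (F f) \<le> K * norm f"
    using bidual_bound[OF F] by blast
  have Sj: "blinfun_apply (S (?j y)) x = T x y" for x y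
    by (simp add: S_apply[OF J] bidual_eval_apply T_in_dual)
  have Sadd: "S (?j (y + z)) = S (?j y) + S (?j z)" for y z
    by (rule blinfun_eqI) (simp add: Sj blinfun.bilinear_simps)
  have Sscale: "S (?j (scaleY c y)) = dual_scale c (S (?j y))" for c y
    by (rule blinfun_eqI) (simp add: Sj dual_scaleI[OF T_in_dual])
  have Sbound: "norm (S (?j y)) \<le> C * norm y" for y
  proof (rule norm_blinfun_bound)
    fix x
    have "norm (T x y) \<le> norm (T x) * norm y" by (rule norm_blinfun)
    also have "\<dots> \<le> C * norm x * norm y" by (intro mult_right_mono T_bound) auto
    finally show "norm (S (?j y) x) \<le> C * norm y * norm x" by (simp add: Sj ac_simps)
  qed (simp add: C_nonneg)
  have scale: "F (S (?j (scaleY c y))) = c * F (S (?j y))" for c y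
    by (simp add: Sscale bidual_dual_scale[OF F] S_in_dual J)
  define g where "g = Blinfun (\<lambda>y. F (S (?j y)))"
  have "bounded_linear (\<lambda>y. F (S (?j y)))"
  proof (rule bounded_linear_intro)
    fix y z r
    show "F (S (?j (y + z))) = F (S (?j y)) + F (S (?j z))"
      by (simp add: Sadd bidual_add[OF F] S_in_dual J)
    show "F (S (?j (r *\<^sub>R y))) = r *\<^sub>R F (S (?j y))"
      using scale[of "of_real r" y] by (simp add: Y.scale_of_real scaleR_conv_of_real)
    have "norm (F (S (?j y))) \<le> K * norm (S (?j y))" by (intro K S_in_dual J)
    also have "\<dots> \<le> K * (C * norm y)" using K(1) by (intro mult_left_mono Sbound) auto
    finally show "norm (F (S (?j y))) \<le> norm y * (K * C)" by (simp add: ac_simps)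
  qed
  then have g_apply: "g y = F (S (?j y))" for y
    by (simp add: g_def bounded_linear_Blinfun_apply)
  have g: "g \<in> dual scaleY" by (simp add: dual_def g_apply scale)
  show thesis
  proof (rule that[OF g], rule ccontr)
    fix G assume G: "G \<in> bidual scaleY" and ne: "F (S G) \<noteq> G g"
    \<comment> \<open>\<open>U\<close> is the open set where the two weak-star continuous sides
      disagree. Density would put some \<open>?j y\<close> into it, yet there they agree by the
      definition of \<open>g\<close>.\<close>
    define U where "U = {G \<in> topspace ?W. F (S G) - G g \<in> - {0}}"
    have "openin ?W U"
      unfolding U_def
      by (rule openin_continuous_map_preimage[where Y = euclidean])
        (auto intro!: continuous_map_diff cont continuous_map_weak_star_eval g)
    moreover have "G \<in> U" using G ne by (simp add: U_def topspace_weak_star_topology_bidual)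
    ultimately obtain I \<epsilon> where I: "finite I" "I \<subseteq> dual scaleY" "\<epsilon> > 0" and
      nbhd: "\<And>H. H \<in> bidual scaleY \<Longrightarrow> (\<And>f. f \<in> I \<Longrightarrow> dist (H f) (G f) < \<epsilon>) \<Longrightarrow> H \<in> U"
      unfolding weak_star_topology_bidual_initial
      by (rule initial_topology_basic_neighbourhood) blast
    obtain L where L: "L > 0" "\<And>f. f \<in> dual scaleY \<Longrightarrow> norm (G f) \<le> L * norm f"
      using bidual_bound[OF G] by blast
    obtain y where "\<And>f. f \<in> I \<Longrightarrow> norm (blinfun_apply f y - G f) < \<epsilon>"
      using helly[OF Y.normed_space_over_axioms G L I] by metis
    then have "?j y \<in> U"
      using I(2) by (intro nbhd J) (auto simp: dist_norm bidual_eval_apply subset_iff)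
    then show False by (simp add: U_def bidual_eval_apply g g_apply)
  qed
qed

text \<open>Both conditions express that the second adjoint of \<open>T\<close> takes values in
  \<open>dual scaleY\<close>. For the converse, the image of the bidual unit ball under it is weakly
  compact and contains the image of the unit ball under \<open>T\<close>.\<close>

theorem weakly_compact_iff_weak_star_continuous:
  "compactin (weak_topology_dual scaleY)
      (weak_topology_dual scaleY closure_of {T x | x. norm x \<le> 1}) \<longleftrightarrow>
    (\<forall>F\<in>bidual scaleX.
      continuous_map (weak_star_topology_bidual scaleY) euclidean (\<lambda>G. F (S G)))"
    (is "?compact \<longleftrightarrow> ?cont")
proof
  assume ?compact
  show ?cont
  proof
    fix F assume "F \<in> bidual scaleX"
    then obtain g K where g: "g \<in> dual scaleY" "\<And>G. G \<in> bidual scaleY \<Longrightarrow> F (S G) = K *\<^sub>R G g"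
      using weakly_compact_imp_bitranspose_value[OF \<open>?compact\<close>] by metis
    have "continuous_map (weak_star_topology_bidual scaleY) euclidean ((\<lambda>z. K *\<^sub>R z) \<circ> (\<lambda>G. G g))"
      by (rule continuous_map_compose[OF continuous_map_weak_star_eval[OF g(1)]])
        (auto intro!: continuous_intros)
    then show "continuous_map (weak_star_topology_bidual scaleY) euclidean (\<lambda>G. F (S G))"
      by (rule continuous_map_eq) (simp add: topspace_weak_star_topology_bidual g(2))
  qed
next
  assume ?cont
  let ?W = "weak_topology_dual scaleY"
  let ?B = "{F \<in> bidual scaleX. \<forall>f\<in>dual scaleX. norm (F f) \<le> norm f}"
  have "\<forall>F\<in>bidual scaleX. \<exists>g. g \<in> dual scaleY \<and> (\<forall>G\<in>bidual scaleY. F (S G) = G g)"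
    using \<open>?cont\<close> weak_star_continuous_imp_bitranspose_value by metis
  \<comment> \<open>\<open>h\<close> is the second adjoint of \<open>T\<close>, with its values
    regarded as elements of \<open>dual scaleY\<close>.\<close>
  then obtain h where h: "\<And>F. F \<in> bidual scaleX \<Longrightarrow> h F \<in> dual scaleY"
    "\<And>F G. F \<in> bidual scaleX \<Longrightarrow> G \<in> bidual scaleY \<Longrightarrow> F (S G) = G (h F)"
    by metis
  \<comment> \<open>Pairing \<open>h F\<close> with \<open>G\<close> gives \<open>F (S G)\<close>,
    which is evaluation of \<open>F\<close> at the fixed functional \<open>S G\<close>.\<close>
  have "continuous_map (weak_star_topology_bidual scaleX) ?W h"
    unfolding weak_topology_dual_initial
  proof (rule continuous_map_into_initial_topology)
    show "bidual scaleY \<noteq> {}" using bidual_eval_in_bidual by blast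
    show "h F \<in> dual scaleY" if "F \<in> topspace (weak_star_topology_bidual scaleX)" for F
      using that h(1) by (simp add: topspace_weak_star_topology_bidual)
    fix G assume G: "G \<in> bidual scaleY"
    show "continuous_map (weak_star_topology_bidual scaleX) euclidean (\<lambda>F. G (h F))"
      by (rule continuous_map_eq[OF continuous_map_weak_star_eval[OF S_in_dual[OF G]]])
        (simp add: topspace_weak_star_topology_bidual h(2) G)
  qed
  then have comp: "compactin ?W (h ` ?B)"
    by (rule image_compactin[OF compactin_bidual_ball])
  then have closed: "closedin ?W (h ` ?B)"
    by (rule compactin_imp_closedin[OF Hausdorff_weak_topology_dual])
  have "{T x | x. norm x \<le> 1} \<subseteq> h ` ?B"
  proof clarify
    fix x :: 'x assume x: "norm x \<le> 1"
    let ?F = "bidual_eval scaleX x"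
    have F: "?F \<in> bidual scaleX" by (rule bidual_eval_in_bidual)
    have "norm (?F f) \<le> norm f" if "f \<in> dual scaleX" for f
      using norm_bidual_eval_le[OF that, of x] mult_right_mono[OF x, of "norm f"] by simp
    \<comment> \<open>The second adjoint extends \<open>T\<close> along the canonical embedding;
      evaluations at points \<open>y\<close> suffice to see this.\<close>
    moreover have "T x = h ?F"
    proof (rule blinfun_eqI)
      fix y
      let ?G = "bidual_eval scaleY y"
      have G: "?G \<in> bidual scaleY" by (rule bidual_eval_in_bidual)
      show "T x y = h ?F y"
        using h(2)[OF F G] h(1)[OF F] G
        by (simp add: bidual_eval_apply S_in_dual S_apply T_in_dual)
    qed
    ultimately show "T x \<in> h ` ?B" using F by blast
  qed
  then have "?W closure_of {T x | x. norm x \<le> 1} \<subseteq> h ` ?B"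
    using closed by (rule closure_of_minimal)
  then show ?compact
    by (rule closed_compactin[OF comp]) simp
qed

end

section \<open>Weakly almost periodic functionals and topological centres\<close>

lemma adj1_norm_le:
  assumes "bounded_bilinear m" "\<And>u v. norm (m u v) \<le> norm u * norm v * L" "L \<ge> 0"
  shows "norm (adj1 m f x) \<le> norm f * L * norm x"
proof (rule norm_blinfun_bound)
  fix v
  have "norm (f (m x v)) \<le> norm f * norm (m x v)" by (rule norm_blinfun)
  also have "\<dots> \<le> norm f * (norm x * norm v * L)" by (intro mult_left_mono assms) auto
  finally show "norm (adj1 m f x v) \<le> norm f * L * norm x * norm v"
    by (simp add: adj1_apply[OF assms(1)] ac_simps)
qed (use assms in auto)

lemma lmult_in_bidual:
  assumes "banach_algebra_over scl" "F \<in> bidual scl"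
  shows "lmult scl a F \<in> bidual scl"
proof -
  interpret banach_algebra_over scl by (rule assms)
  note m = bounded_bilinear_mult
  have D: "adj1 (*) f a \<in> dual scl" if "f \<in> dual scl" for f
    by (rule adj1_in_dual[OF m _ that]) (rule scale_mult_right)
  obtain K where K: "K > 0" "\<And>f. f \<in> dual scl \<Longrightarrow> norm (F f) \<le> K * norm f"
    using bidual_bound[OF assms(2)] by blast
  show ?thesis
  proof (rule bidualI[where K = "K * norm a"])
    fix f g c assume f: "f \<in> dual scl"
    have "adj1 (*) (dual_scale c f) a = dual_scale c (adj1 (*) f a)"
      by (rule blinfun_eqI) (simp add: adj1_apply[OF m])
    then show "lmult scl a F (dual_scale c f) = c * lmult scl a F f"
      using f by (simp add: lmult_def dual_scale_in_dual bidual_dual_scale[OF assms(2)] D)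
    have "norm (F (adj1 (*) f a)) \<le> K * norm (adj1 (*) f a)" by (intro K D f)
    also have "\<dots> \<le> K * (norm f * 1 * norm a)"
      using K(1) by (intro mult_left_mono adj1_norm_le[OF m]) (auto intro: norm_mult_ineq)
    finally show "norm (lmult scl a F f) \<le> K * norm a * norm f"
      using f by (simp add: lmult_def ac_simps)
    assume g: "g \<in> dual scl"
    have "adj1 (*) (f + g) a = adj1 (*) f a + adj1 (*) g a"
      by (rule blinfun_eqI) (simp add: adj1_apply[OF m] blinfun.bilinear_simps)
    then show "lmult scl a F (f + g) = lmult scl a F f + lmult scl a F g"
      using f g by (simp add: lmult_def add_in_dual bidual_add[OF assms(2)] D)
  qed (simp add: lmult_def)
qed

context left_banach_module
begin

lemma adj1_act_in_dual: "f \<in> dual scaleB \<Longrightarrow> adj1 act f a \<in> dual scaleB"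
  by (rule adj1_in_dual[OF act_bounded_bilinear]) (rule act_scale_right)

lemmas adj2_act = adj2_apply[OF act_bounded_bilinear act_scale_right A.normed_space_over_axioms act_scale_left]

lemma operator_into_dual_adj1:
  assumes "f \<in> dual scaleB"
  obtains C where "operator_into_dual scaleA scaleB (adj1 act f) (\<lambda>G. adj2 act G f) C"
proof -
  obtain L where L: "\<And>u v. norm (act u v) \<le> norm u * norm v * L" "L \<ge> 0"
    using bounded_bilinear.nonneg_bounded[OF act_bounded_bilinear] by auto
  have "operator_into_dual scaleA scaleB (adj1 act f) (\<lambda>G. adj2 act G f) (norm f * L)"
    by unfold_locales
      (use assms L in \<open>auto simp: adj1_act_in_dual adj2_act adj1_norm_le[OF act_bounded_bilinear]\<close>)
  then show thesis by (rule that)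
qed

text \<open>Membership in \<open>wap_l\<close> is weak compactness of
  \<open>a \<mapsto> adj1 act f a\<close>, so this is Gantmacher's theorem with the adjoint
  \<open>G \<mapsto> adj2 act G f\<close>.\<close>

lemma wap_l_iff:
  assumes "f \<in> dual scaleB"
  shows "f \<in> wap_l scaleB act \<longleftrightarrow> (\<forall>F\<in>bidual scaleA.
    continuous_map (weak_star_topology_bidual scaleB) euclidean (\<lambda>G. F (adj2 act G f)))"
proof -
  obtain C where "operator_into_dual scaleA scaleB (adj1 act f) (\<lambda>G. adj2 act G f) C"
    using operator_into_dual_adj1[OF assms] .
  then show ?thesis
    using assms by (simp add: wap_l_def operator_into_dual.weakly_compact_iff_weak_star_continuous)
qed

text \<open>The module law \<open>act_mult\<close> enters here: acting on \<open>f\<close> by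
  \<open>a\<close> and then by \<open>x\<close> is acting by \<open>a * x\<close>. It moves the
  factor \<open>a\<close> from the algebra side into the functional on \<open>B\<close>.\<close>

lemma adj1_mult_adj2:
  assumes "f \<in> dual scaleB" "G \<in> bidual scaleB"
  shows "adj1 (*) (adj2 act G f) a = adj2 act G (adj1 act f a)"
proof (rule blinfun_eqI)
  fix x
  have "adj1 act (adj1 act f a) x = adj1 act f (a * x)"
    by (rule blinfun_eqI) (simp add: adj1_apply[OF act_bounded_bilinear] act_mult)
  then show "adj1 (*) (adj2 act G f) a x = adj2 act G (adj1 act f a) x"
    using assms by (simp add: adj1_apply[OF bounded_bilinear_mult] adj2_act adj1_act_in_dual)
qed

lemma adj3_lmult:
  assumes "f \<in> dual scaleB" "G \<in> bidual scaleB"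
  shows "adj3 scaleB act (lmult scaleA a F) G f = F (adj2 act G (adj1 act f a))"
  using assms by (simp add: adj3_def lmult_def adj2_act adj1_mult_adj2)

text \<open>Continuity into the weak-star topology presupposes that the map lands in its
  carrier.\<close>

lemma adj3_in_bidual:
  assumes F: "F \<in> bidual scaleA" and G: "G \<in> bidual scaleB"
  shows "adj3 scaleB act F G \<in> bidual scaleB"
proof -
  obtain K where K: "K > 0" "\<And>f. f \<in> dual scaleA \<Longrightarrow> norm (F f) \<le> K * norm f"
    using bidual_bound[OF F] by blast
  obtain M where M: "M > 0" "\<And>f. f \<in> dual scaleB \<Longrightarrow> norm (G f) \<le> M * norm f"
    using bidual_bound[OF G] by blast
  obtain L where L: "\<And>u v. norm (act u v) \<le> norm u * norm v * L" "L \<ge> 0"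
    using bounded_bilinear.nonneg_bounded[OF act_bounded_bilinear] by auto
  note m = act_bounded_bilinear
  show ?thesis
  proof (rule bidualI[where K = "K * M * L"])
    fix f g c assume f: "f \<in> dual scaleB"
    have "adj1 act (dual_scale c f) x = dual_scale c (adj1 act f x)" for x
      by (rule blinfun_eqI) (simp add: adj1_apply[OF m])
    then have "adj2 act G (dual_scale c f) = dual_scale c (adj2 act G f)"
      by (intro blinfun_eqI)
        (simp add: adj2_act f G dual_scale_in_dual adj1_act_in_dual bidual_dual_scale[OF G])
    then show "adj3 scaleB act F G (dual_scale c f) = c * adj3 scaleB act F G f"
      by (simp add: adj3_def f G dual_scale_in_dual adj2_act bidual_dual_scale[OF F])
    have "norm (adj2 act G f) \<le> M * L * norm f"
    proof (rule norm_blinfun_bound)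
      fix x
      have "norm (G (adj1 act f x)) \<le> M * norm (adj1 act f x)" by (intro M adj1_act_in_dual f)
      also have "\<dots> \<le> M * (norm f * L * norm x)"
        using M(1) by (intro mult_left_mono adj1_norm_le[OF m] L) auto
      finally show "norm (adj2 act G f x) \<le> M * L * norm f * norm x"
        by (simp add: adj2_act f G ac_simps)
    qed (use M(1) L(2) in auto)
    then have "K * norm (adj2 act G f) \<le> K * (M * L * norm f)"
      using K(1) by (intro mult_left_mono) auto
    then show "norm (adj3 scaleB act F G f) \<le> K * M * L * norm f"
      using K(2)[of "adj2 act G f"] by (simp add: adj3_def f G adj2_act ac_simps)
    assume g: "g \<in> dual scaleB"
    have "adj1 act (f + g) x = adj1 act f x + adj1 act g x" for x
      by (rule blinfun_eqI) (simp add: adj1_apply[OF m] blinfun.bilinear_simps)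
    then have "adj2 act G (f + g) = adj2 act G f + adj2 act G g"
      by (intro blinfun_eqI)
        (simp add: adj2_act f g G add_in_dual adj1_act_in_dual bidual_add[OF G] blinfun.bilinear_simps)
    then show "adj3 scaleB act F G (f + g) = adj3 scaleB act F G f + adj3 scaleB act F G g"
      by (simp add: adj3_def f g G add_in_dual adj2_act bidual_add[OF F])
  qed (simp add: adj3_def)
qed

text \<open>The weak-star topology is initial for the evaluations, so continuity can be tested one
  functional \<open>f\<close> at a time.\<close>

lemma Z_bidual_iff:
  "F \<in> Z_bidual scaleA scaleB act \<longleftrightarrow> F \<in> bidual scaleA \<and> (\<forall>f\<in>dual scaleB.
    continuous_map (weak_star_topology_bidual scaleB) euclidean (\<lambda>G. adj3 scaleB act F G f))"
    (is "_ \<longleftrightarrow> _ \<and> ?cont")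
proof -
  let ?W = "weak_star_topology_bidual scaleB"
  have "continuous_map ?W ?W (adj3 scaleB act F) \<longleftrightarrow> ?cont" if F: "F \<in> bidual scaleA"
  proof
    assume c: "continuous_map ?W ?W (adj3 scaleB act F)"
    show ?cont
      using continuous_map_compose[OF c continuous_map_weak_star_eval] by (auto simp: o_def)
  next
    assume ?cont
    moreover have "dual scaleB \<noteq> {}" using zero_in_dual by blast
    ultimately show "continuous_map ?W ?W (adj3 scaleB act F)"
      unfolding weak_star_topology_bidual_initial[of scaleB]
      by (intro continuous_map_into_initial_topology)
        (auto simp: adj3_in_bidual[OF F] topspace_initial_topology)
  qed
  then show ?thesis by (auto simp: Z_bidual_def)
qed

text \<open>The hypothesis concerns \<open>lmult scaleA a F\<close> instead of \<open>F\<close>, so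
  that \<open>F\<close> may also be a functional given only on \<open>AstarA scaleA\<close>.\<close>

lemma lmult_in_Z_bidual_iff:
  assumes "lmult scaleA a F \<in> bidual scaleA"
  shows "lmult scaleA a F \<in> Z_bidual scaleA scaleB act \<longleftrightarrow> (\<forall>f\<in>dual scaleB.
    continuous_map (weak_star_topology_bidual scaleB) euclidean (\<lambda>G. F (adj2 act G (adj1 act f a))))"
proof -
  have "continuous_map (weak_star_topology_bidual scaleB) euclidean
      (\<lambda>G. adj3 scaleB act (lmult scaleA a F) G f) \<longleftrightarrow>
    continuous_map (weak_star_topology_bidual scaleB) euclidean (\<lambda>G. F (adj2 act G (adj1 act f a)))"
    if "f \<in> dual scaleB" for f
    by (auto simp: topspace_weak_star_topology_bidual adj3_lmult[OF that] elim!: continuous_map_eq)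
  then show ?thesis using assms by (simp add: Z_bidual_iff)
qed

text \<open>Evaluating the weak-star continuous map \<open>G \<mapsto> adj3 scaleB act F G\<close>
  at \<open>adj1 act f a\<close> produces exactly the scalar functions of the preceding
  criterion.\<close>

lemma lmult_Z_AstarA_dual_in_Z_bidual:
  assumes F: "F \<in> Z_AstarA_dual scaleA scaleB act" and "lmult scaleA a F \<in> bidual scaleA"
  shows "lmult scaleA a F \<in> Z_bidual scaleA scaleB act"
  unfolding lmult_in_Z_bidual_iff[OF assms(2)]
proof
  fix f assume "f \<in> dual scaleB"
  then have f: "adj1 act f a \<in> dual scaleB" by (rule adj1_act_in_dual)
  let ?W = "weak_star_topology_bidual scaleB"
  have "continuous_map ?W ?W (\<lambda>G. adj3 scaleB act F G)"
    using F by (simp add: Z_AstarA_dual_def)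
  from continuous_map_compose[OF this continuous_map_weak_star_eval[OF f]]
  show "continuous_map ?W euclidean (\<lambda>G. F (adj2 act G (adj1 act f a)))"
    by (simp add: o_def adj3_def f)
qed

end

theorem mainTheorem4:
  fixes scaleA :: "'k::{real_normed_field,euclidean_space} \<Rightarrow> 'a::{real_normed_algebra,banach} \<Rightarrow> 'a"
    and scaleB :: "'k \<Rightarrow> 'b::banach \<Rightarrow> 'b"
    and \<pi> :: "'a \<Rightarrow> 'b \<Rightarrow> 'b"
  assumes "left_banach_module scaleA scaleB \<pi>"
  shows "(BstarA scaleB \<pi> \<subseteq> wap_l scaleB \<pi> \<longleftrightarrow>
            A_mult scaleA (bidual scaleA) \<subseteq> Z_bidual scaleA scaleB \<pi>) \<and>
         (A_mult scaleA (bidual scaleA) \<subseteq> A_mult scaleA (Z_AstarA_dual scaleA scaleB \<pi>) \<longrightarrow>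
            A_mult scaleA (bidual scaleA) \<subseteq> Z_bidual scaleA scaleB \<pi>)"
proof -
  interpret left_banach_module scaleA scaleB \<pi> by (rule assms)
  note lmult = lmult_in_bidual[OF A.banach_algebra_over_axioms]
  \<comment> \<open>Both inclusions reduce to the same family of scalar continuity conditions,
    indexed by \<open>f\<close>, \<open>a\<close> and \<open>F\<close>.\<close>
  have "BstarA scaleB \<pi> \<subseteq> wap_l scaleB \<pi> \<longleftrightarrow>
      (\<forall>f\<in>dual scaleB. \<forall>a. \<forall>F\<in>bidual scaleA. continuous_map (weak_star_topology_bidual scaleB)
        euclidean (\<lambda>G. F (adj2 \<pi> G (adj1 \<pi> f a))))"
  proof -
    have "BstarA scaleB \<pi> \<subseteq> wap_l scaleB \<pi> \<longleftrightarrow> (\<forall>f\<in>dual scaleB. \<forall>a. adj1 \<pi> f a \<in> wap_l scaleB \<pi>)"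
      by (auto simp: BstarA_def)
    then show ?thesis by (simp add: wap_l_iff adj1_act_in_dual)
  qed
  also have "\<dots> \<longleftrightarrow> A_mult scaleA (bidual scaleA) \<subseteq> Z_bidual scaleA scaleB \<pi>"
  proof -
    have "A_mult scaleA (bidual scaleA) \<subseteq> Z_bidual scaleA scaleB \<pi> \<longleftrightarrow>
        (\<forall>a. \<forall>F\<in>bidual scaleA. lmult scaleA a F \<in> Z_bidual scaleA scaleB \<pi>)"
      by (auto simp: A_mult_def)
    then show ?thesis by (auto simp: lmult_in_Z_bidual_iff lmult)
  qed
  finally have "BstarA scaleB \<pi> \<subseteq> wap_l scaleB \<pi> \<longleftrightarrow>
      A_mult scaleA (bidual scaleA) \<subseteq> Z_bidual scaleA scaleB \<pi>" .
  moreover have "A_mult scaleA (bidual scaleA) \<subseteq> Z_bidual scaleA scaleB \<pi>"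
    if sub: "A_mult scaleA (bidual scaleA) \<subseteq> A_mult scaleA (Z_AstarA_dual scaleA scaleB \<pi>)"
  proof
    fix H assume H: "H \<in> A_mult scaleA (bidual scaleA)"
    \<comment> \<open>Membership in the bidual comes from the left side of the inclusion, the form
      of \<open>H\<close> used below from the right side.\<close>
    then have "H \<in> bidual scaleA" by (auto simp: A_mult_def lmult)
    moreover obtain a F where "H = lmult scaleA a F" "F \<in> Z_AstarA_dual scaleA scaleB \<pi>"
      using subsetD[OF sub H] by (auto simp: A_mult_def)
    ultimately show "H \<in> Z_bidual scaleA scaleB \<pi>"
      using lmult_Z_AstarA_dual_in_Z_bidual by simp
  qed
  ultimately show ?thesis by blast
qed

end
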